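(* Let $f:\mathbb{T}^\kappa\to\mathbb{R}$ and $g:\mathbb{T}\to\mathbb{R}$ be functions. Fix $0<\alpha\le 1$ and put $\gamma:=1-\alpha$. Then $$\int_{a}^{b}f(t)\,\bigl({}_a\Delta_h^\alpha g\bigr)(t)\,\Delta t = h^\gamma f(\rho(b))g(b)-h^\gamma f(a)g(a)+\int_{a}^{\rho(b)}\bigl({}_h\Delta_{\rho(b)}^\alpha f\bigr)(t)\,g^\sigma(t)\,\Delta t$$ $$\qquad+\frac{\gamma}{\Gamma(\gamma+1)}\,g(a)\left(\int_{a}^{b}(t+\gamma h-a)_h^{(\gamma-1)}f(t)\,\Delta t-\int_{\sigma(a)}^{b}(t+\gamma h-\sigma(a))_h^{(\gamma-1)}f(t)\,\Delta t\right).$$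
   Context: Let $a\in\mathbb{R}$, $h>0$, $b=a+kh$ with $k\in\mathbb{N}$, $k\ge 1$, and $\mathbb{T}=\{a,a+h,\dots,b\}$, $\mathbb{T}^\kappa=\{a,a+h,\dots,b-h\}$, $\mathbb{T}^{\kappa^2}=\{a,\dots,b-2h\}$ (empty if $k=1$). Put $\sigma(t)=t+h$, $\rho(t)=t-h$, $f^\sigma(t)=f(\sigma(t))$. The delta derivative is $f^\Delta(t)=\frac{f(t+h)-f(t)}{h}$. The delta integral is $\int_c^d f(t)\Delta t=\sum_{i=0}^{(d-c)/h-1}f(c+ih)\,h$ for $d-c\in h\mathbb{N}_0$ (equal to $0$ if $c=d$). The $h$-factorial function is $x_h^{(y)}:=h^y\,\Gamma(\frac{x}{h}+1)/\Gamma(\frac{x}{h}+1-y)$ for $x,y\in\mathbb{R}$, with the convention that division at a pole yields zero. Fractional $h$-sums. Let $\nu>0$. For a function $f$ on a grid $\{a,a+h,\dots,c\}$ (with $c=b$ or $c=\rho(b)$) and $t$ in this grid, $${}_a\Delta_h^{-\nu}f(t+\nu h)=\frac{1}{\Gamma(\nu)}\sum_{s\in\{a,a+h,\dots,t\}}(t+\nu h-\sigma(s))_h^{(\nu-1)}f(s)\,h,$$ $${}_h\Delta_c^{-\nu}f(t-\nu h)=\frac{1}{\Gamma(\nu)}\sum_{s\in\{t,t+h,\dots,c\}}(s+\nu h-\sigma(t))_h^{(\nu-1)}f(s)\,h,$$ and for $\nu=0$: ${}_a\Delta_h^{0}f(t)={}_h\Delta_c^{0}f(t)=f(t)$. Fractional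 differences. For $0<\alpha\le1$ and $\gamma=1-\alpha$, the left and right fractional differences are ${}_a\Delta_h^\alpha f(t):=\bigl({}_a\Delta_h^{-\gamma}f(t+\gamma h)\bigr)^\Delta$ and ${}_h\Delta_c^\alpha f(t):=-\bigl({}_h\Delta_c^{-\gamma}f(t-\gamma h)\bigr)^\Delta$, where the delta derivative is taken of the functions $t\mapsto {}_a\Delta_h^{-\gamma}f(t+\gamma h)$ and $t\mapsto{}_h\Delta_c^{-\gamma}f(t-\gamma h)$; they are defined for $t\in\{a,\dots,c-h\}$. In particular ${}_h\Delta_{\rho(b)}^\alpha$ applies to functions on $\mathbb{T}^\kappa$ and yields functions on $\mathbb{T}^{\kappa^2}$. *)

theory Defs
  imports "HOL-Analysis.Gamma_Function"
begin

text \<open>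
  Functions on a grid are rendered as total functions on the reals. All sums below range only over
  points of the relevant grid, so values elsewhere never matter in the intended use.
\<close>

definition hsigma :: "real \<Rightarrow> real \<Rightarrow> real" where
  "hsigma h t = t + h"

definition hrho :: "real \<Rightarrow> real \<Rightarrow> real" where
  "hrho h t = t - h"

text \<open>The grid \<open>{c, c + h, \<dots>, d}\<close>, for \<open>h > 0\<close> and \<open>d - c\<close> a natural multiple of \<open>h\<close>.\<close>

definition hgrid :: "real \<Rightarrow> real \<Rightarrow> real \<Rightarrow> real set" where
  "hgrid h c d = {c + real i * h | i. c + real i * h \<le> d}"

definition delta_deriv :: "real \<Rightarrow> (real \<Rightarrow> real) \<Rightarrow> real \<Rightarrow> real" where
  "delta_deriv h f t = (f (t + h) - f t) / h"

text \<open>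
  Only meant for \<open>d - c\<close> a natural multiple of \<open>h\<close>; then \<open>(d - c) / h\<close> is already a natural number
  and \<open>nat \<lfloor>_\<rfloor>\<close> merely converts its type.
\<close>

definition delta_integral :: "real \<Rightarrow> real \<Rightarrow> real \<Rightarrow> (real \<Rightarrow> real) \<Rightarrow> real" where
  "delta_integral h c d f = (\<Sum>i<nat \<lfloor>(d - c) / h\<rfloor>. f (c + real i * h) * h)"

text \<open>
  The convention that division at a pole yields zero is built in: \<open>Gamma\<close> is \<open>0\<close> at its poles and
  \<open>x / 0 = 0\<close>.
\<close>

definition hfactorial :: "real \<Rightarrow> real \<Rightarrow> real \<Rightarrow> real" where
  "hfactorial h x y = h powr y * Gamma (x / h + 1) / Gamma (x / h + 1 - y)"

text \<open>
  The fractional sums of order \<open>\<nu> \<ge> 0\<close> live on shifted grids: their argument \<open>u\<close> is \<open>t + \<nu> h\<close>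
  (left) resp. \<open>t - \<nu> h\<close> (right) for a grid point \<open>t\<close>.
\<close>

definition left_frac_sum :: "real \<Rightarrow> real \<Rightarrow> real \<Rightarrow> (real \<Rightarrow> real) \<Rightarrow> real \<Rightarrow> real" where
  "left_frac_sum h a \<nu> f u =
     (if \<nu> = 0 then f u
      else let t = u - \<nu> * h in
        1 / Gamma \<nu> *
          (\<Sum>s \<in> hgrid h a t. hfactorial h (t + \<nu> * h - hsigma h s) (\<nu> - 1) * f s * h))"

definition right_frac_sum :: "real \<Rightarrow> real \<Rightarrow> real \<Rightarrow> (real \<Rightarrow> real) \<Rightarrow> real \<Rightarrow> real" where
  "right_frac_sum h c \<nu> f u =
     (if \<nu> = 0 then f u
      else let t = u + \<nu> * h in
        1 / Gamma \<nu> *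
          (\<Sum>s \<in> hgrid h t c. hfactorial h (s + \<nu> * h - hsigma h t) (\<nu> - 1) * f s * h))"

definition left_frac_diff :: "real \<Rightarrow> real \<Rightarrow> real \<Rightarrow> (real \<Rightarrow> real) \<Rightarrow> real \<Rightarrow> real" where
  "left_frac_diff h a \<alpha> f =
     (let \<gamma> = 1 - \<alpha> in delta_deriv h (\<lambda>t. left_frac_sum h a \<gamma> f (t + \<gamma> * h)))"

definition right_frac_diff :: "real \<Rightarrow> real \<Rightarrow> real \<Rightarrow> (real \<Rightarrow> real) \<Rightarrow> real \<Rightarrow> real" where
  "right_frac_diff h c \<alpha> f t =
     (let \<gamma> = 1 - \<alpha> in - delta_deriv h (\<lambda>t. right_frac_sum h c \<gamma> f (t - \<gamma> * h)) t)"

end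

theory Submission
  imports Defs
begin

text \<open>
  On the grid \<open>a + n h\<close> both fractional sums of order \<open>\<gamma>\<close> are discrete convolutions with one and the
  same weight sequence \<open>w n = h powr \<gamma> * pochhammer \<gamma> n / fact n\<close>: divided by \<open>Gamma \<gamma>\<close>, the quotients
  of Gamma values hidden in the \<open>h\<close>-factorial are Pochhammer symbols over factorials (lemmas \<open>left_frac_sum_grid\<close> and
  \<open>right_frac_sum_grid\<close>). In this form \<open>\<gamma> = 0\<close> is no longer special, since then \<open>w\<close> is the unit
  sequence \<open>1, 0, 0, \<dots>\<close>.

  Exchanging the order of summation over a triangle shows that the convolution looking to the left
  is adjoint to the one looking to the right. Shifting the left convolution of \<open>g\<close> by one step gives
  the left convolution of the shifted sequence, plus the single term \<open>w (n + 1) * g 0\<close>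
  contributed by the new starting point. These two facts turn the left hand side into a sum of
  \<open>g\<close> against differences of the right convolution of \<open>f\<close>; what remains is the boundary term at
  \<open>b\<close>, where the right convolution is \<open>w 0 * f (b - h)\<close>, and three terms in \<open>g a\<close>
  (lemma \<open>convolution_summation_by_parts\<close>). Multiplied by \<open>\<gamma> / Gamma (\<gamma> + 1)\<close>, the two integrals
  next to \<open>g a\<close> in the theorem are the sums of \<open>w (n + 1) * f n\<close> and of \<open>w (n + 1) * f (n + 1)\<close>,
  where \<open>f n\<close> stands for the value at \<open>a + n h\<close>.
\<close>

text \<open>
  The left and the right convolution with \<open>w\<close> are adjoint: both sides sum
  \<open>w i * f n * g j\<close> over all \<open>n = j + i \<le> m\<close>.
\<close>

lemma convolution_adjoint:
  fixes f g w :: "nat \<Rightarrow> 'a::comm_semiring_0"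
  shows "(\<Sum>n\<le>m. f n * (\<Sum>j\<le>n. w (n - j) * g j)) = (\<Sum>j\<le>m. g j * (\<Sum>i\<le>m - j. w i * f (j + i)))"
  unfolding sum_distrib_left
  by (simp add: sum.Sigma,
      rule sum.reindex_bij_witness[where i = "\<lambda>(j, i). (j + i, j)" and j = "\<lambda>(n, j). (j, n - j)"])
     (auto simp: mult_ac)

text \<open>
  The difference of left convolutions is expanded with the shift rule for \<open>L\<close>; adjointness then
  applies to \<open>g\<close> shifted by one step and to \<open>g\<close> itself. The two resulting sums in \<open>R\<close> overlap except
  at \<open>R m\<close> and \<open>R 0\<close>.
\<close>

lemma convolution_summation_by_parts:
  fixes f g w :: "nat \<Rightarrow> 'a::comm_ring"
  defines "L \<equiv> \<lambda>n. \<Sum>j\<le>n. w (n - j) * g j"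
    and "R \<equiv> \<lambda>m j. \<Sum>i\<le>m - j. w i * f (j + i)"
  shows "(\<Sum>n\<le>m. f n * (L (Suc n) - L n)) =
      w 0 * f m * g (Suc m) - w 0 * f 0 * g 0
    + (\<Sum>j<m. (R m j - R m (Suc j)) * g (Suc j))
    + g 0 * ((\<Sum>n\<le>m. w (Suc n) * f n) - (\<Sum>n<m. w (Suc n) * f (Suc n)))"
proof -
  have shift: "L (Suc n) = w (Suc n) * g 0 + (\<Sum>j\<le>n. w (n - j) * g (Suc j))" for n
    unfolding L_def by (subst sum.atMost_Suc_shift) simp
  have "(\<Sum>n\<le>m. f n * (L (Suc n) - L n)) =
      g 0 * (\<Sum>n\<le>m. w (Suc n) * f n) + (\<Sum>n\<le>m. f n * (\<Sum>j\<le>n. w (n - j) * g (Suc j)))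
      - (\<Sum>n\<le>m. f n * L n)"
    unfolding shift
    by (simp add: right_diff_distrib distrib_left sum_subtractf sum.distrib sum_distrib_left mult_ac)
  also have "(\<Sum>n\<le>m. f n * (\<Sum>j\<le>n. w (n - j) * g (Suc j))) = (\<Sum>j\<le>m. g (Suc j) * R m j)"
    unfolding R_def by (rule convolution_adjoint)
  also have "\<dots> = g (Suc m) * (w 0 * f m) + (\<Sum>j<m. g (Suc j) * R m j)"
    by (simp add: lessThan_Suc_atMost[symmetric] R_def add.commute)
  also have "(\<Sum>n\<le>m. f n * L n) = (\<Sum>j\<le>m. g j * R m j)"
    unfolding R_def L_def by (rule convolution_adjoint)
  also have "\<dots> = g 0 * R m 0 + (\<Sum>j<m. g (Suc j) * R m (Suc j))"
    by (simp add: sum.atMost_shift)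
  also have "R m 0 = w 0 * f 0 + (\<Sum>n<m. w (Suc n) * f (Suc n))"
    unfolding R_def by (simp add: sum.atMost_shift)
  finally show ?thesis
    by (simp add: algebra_simps sum_subtractf)
qed

text \<open>
  The coefficients of the power series \<open>(h / (1 - x)) powr \<gamma>\<close>; convolution with them is fractional
  summation of order \<open>\<gamma>\<close>.
\<close>

definition frac_weight :: "real \<Rightarrow> real \<Rightarrow> nat \<Rightarrow> real" where
  "frac_weight h \<gamma> n = h powr \<gamma> * pochhammer \<gamma> n / fact n"

lemma frac_weight_0: "frac_weight h \<gamma> 0 = h powr \<gamma>"
  by (simp add: frac_weight_def)

lemma frac_weight_order_0: "h > 0 \<Longrightarrow> frac_weight h 0 n = (if n = 0 then 1 else 0)"
  by (simp add: frac_weight_def pochhammer_0_left)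

lemma hfactorial_grid:
  assumes "h > 0"
  shows "hfactorial h ((real n + \<gamma> - 1) * h) (\<gamma> - 1) * h = h powr \<gamma> * Gamma (\<gamma> + real n) / fact n"
proof -
  have "hfactorial h ((real n + \<gamma> - 1) * h) (\<gamma> - 1) =
      h powr (\<gamma> - 1) * Gamma (\<gamma> + real n) / Gamma (1 + real n)"
    using assms by (simp add: hfactorial_def add_ac)
  moreover have "h powr (\<gamma> - 1) * h = h powr \<gamma>"
    using assms by (simp add: powr_diff)
  ultimately show ?thesis
    by (simp add: Gamma_fact flip: \<open>h powr (\<gamma> - 1) * h = h powr \<gamma>\<close>)
qed

lemma hfactorial_eq_frac_weight:
  assumes "h > 0" and "\<gamma> > 0"
  shows "1 / Gamma \<gamma> * (hfactorial h ((real n + \<gamma> - 1) * h) (\<gamma> - 1) * h) = frac_weight h \<gamma> n"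
proof -
  have "\<gamma> \<notin> \<int>\<^sub>\<le>\<^sub>0"
    using \<open>\<gamma> > 0\<close> by (auto elim!: nonpos_Ints_cases)
  then show ?thesis
    unfolding hfactorial_grid[OF \<open>h > 0\<close>] frac_weight_def by (simp add: pochhammer_Gamma)
qed

text \<open>
  For \<open>\<gamma> > 0\<close> the factor \<open>\<gamma> / Gamma (\<gamma> + 1)\<close> is just \<open>1 / Gamma \<gamma>\<close>. Written this way it also makes
  sense at \<open>\<gamma> = 0\<close>, where both sides vanish because the weights are supported at \<open>0\<close>.
\<close>

lemma hfactorial_eq_frac_weight_Suc:
  assumes "h > 0" and "\<gamma> \<ge> 0"
  shows "\<gamma> / Gamma (\<gamma> + 1) * (hfactorial h ((real n + \<gamma>) * h) (\<gamma> - 1) * h) = frac_weight h \<gamma> (Suc n)"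
proof -
  have "\<gamma> + 1 \<notin> \<int>\<^sub>\<le>\<^sub>0"
    using \<open>\<gamma> \<ge> 0\<close> by (auto elim!: nonpos_Ints_cases)
  then have "Gamma (\<gamma> + real (Suc n)) = pochhammer (\<gamma> + 1) n * Gamma (\<gamma> + 1)" "Gamma (\<gamma> + 1) \<noteq> 0"
    by (simp_all add: pochhammer_Gamma Gamma_eq_zero_iff add_ac)
  then show ?thesis
    using hfactorial_grid[OF \<open>h > 0\<close>, of "Suc n" \<gamma>]
    by (simp add: frac_weight_def pochhammer_rec algebra_simps)
qed

lemma sum_hgrid:
  assumes "h > 0"
  shows "(\<Sum>s\<in>hgrid h c (c + real n * h). F s) = (\<Sum>i\<le>n. F (c + real i * h))"
proof -
  have "hgrid h c (c + real n * h) = (\<lambda>i. c + real i * h) ` {..n}"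
    using assms by (auto simp: hgrid_def)
  moreover have "inj_on (\<lambda>i. c + real i * h) {..n}"
    using assms by (auto simp: inj_on_def)
  ultimately show ?thesis
    by (simp add: sum.reindex)
qed

lemma left_frac_sum_grid:
  assumes "h > 0" and "\<gamma> \<ge> 0"
  shows "left_frac_sum h a \<gamma> g (a + real n * h + \<gamma> * h) =
      (\<Sum>j\<le>n. frac_weight h \<gamma> (n - j) * g (a + real j * h))"
proof (cases "\<gamma> = 0")
  case True
  have "(\<Sum>j\<le>n. frac_weight h 0 (n - j) * g (a + real j * h)) = (\<Sum>j\<in>{n}. g (a + real j * h))"
    by (rule sum.mono_neutral_cong_right) (use \<open>h > 0\<close> in \<open>auto simp: frac_weight_order_0\<close>)
  with True show ?thesis
    by (simp add: left_frac_sum_def)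
next
  case False
  have arg: "a + real n * h + \<gamma> * h - hsigma h (a + real j * h) = (real (n - j) + \<gamma> - 1) * h"
    if "j \<le> n" for j
    using that by (simp add: hsigma_def of_nat_diff algebra_simps)
  have "left_frac_sum h a \<gamma> g (a + real n * h + \<gamma> * h) =
      1 / Gamma \<gamma> * (\<Sum>j\<le>n. hfactorial h ((real (n - j) + \<gamma> - 1) * h) (\<gamma> - 1) * g (a + real j * h) * h)"
    using False \<open>h > 0\<close> by (simp add: left_frac_sum_def sum_hgrid arg cong: sum.cong_simp)
  also have "\<dots> = (\<Sum>j\<le>n. 1 / Gamma \<gamma> * (hfactorial h ((real (n - j) + \<gamma> - 1) * h) (\<gamma> - 1) * h)
      * g (a + real j * h))"
    by (simp add: sum_distrib_left mult_ac)
  also have "\<dots> = (\<Sum>j\<le>n. frac_weight h \<gamma> (n - j) * g (a + real j * h))"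
    using assms False by (subst hfactorial_eq_frac_weight) auto
  finally show ?thesis .
qed

lemma right_frac_sum_grid:
  assumes "h > 0" and "\<gamma> \<ge> 0"
  shows "right_frac_sum h (t + real n * h) \<gamma> f (t - \<gamma> * h) =
      (\<Sum>i\<le>n. frac_weight h \<gamma> i * f (t + real i * h))"
proof (cases "\<gamma> = 0")
  case True
  then show ?thesis
    using \<open>h > 0\<close> by (simp add: right_frac_sum_def frac_weight_order_0 sum.atMost_shift)
next
  case False
  have arg: "t + real i * h + \<gamma> * h - hsigma h t = (real i + \<gamma> - 1) * h" for i
    by (simp add: hsigma_def algebra_simps)
  have "right_frac_sum h (t + real n * h) \<gamma> f (t - \<gamma> * h) =
      1 / Gamma \<gamma> * (\<Sum>i\<le>n. hfactorial h ((real i + \<gamma> - 1) * h) (\<gamma> - 1) * f (t + real i * h) * h)"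
    using False \<open>h > 0\<close> by (simp add: right_frac_sum_def sum_hgrid arg)
  also have "\<dots> = (\<Sum>i\<le>n. 1 / Gamma \<gamma> * (hfactorial h ((real i + \<gamma> - 1) * h) (\<gamma> - 1) * h)
      * f (t + real i * h))"
    by (simp add: sum_distrib_left mult_ac)
  also have "\<dots> = (\<Sum>i\<le>n. frac_weight h \<gamma> i * f (t + real i * h))"
    using assms False by (subst hfactorial_eq_frac_weight) auto
  finally show ?thesis .
qed

lemma delta_integral_grid:
  assumes "h > 0"
  shows "delta_integral h c (c + real n * h) F = (\<Sum>i<n. F (c + real i * h) * h)"
  using assms by (simp add: delta_integral_def)

theorem theorem3p2:
  fixes a b h \<alpha> \<gamma> :: real and k :: nat and f g :: "real \<Rightarrow> real"
  assumes "h > 0" and "k \<ge> 1" and "b = a + real k * h"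
    and "0 < \<alpha>" and "\<alpha> \<le> 1" and "\<gamma> = 1 - \<alpha>"
  shows "delta_integral h a b (\<lambda>t. f t * left_frac_diff h a \<alpha> g t) =
      h powr \<gamma> * f (hrho h b) * g b - h powr \<gamma> * f a * g a
    + delta_integral h a (hrho h b) (\<lambda>t. right_frac_diff h (hrho h b) \<alpha> f t * g (hsigma h t))
    + \<gamma> / Gamma (\<gamma> + 1) * g a *
        (delta_integral h a b (\<lambda>t. hfactorial h (t + \<gamma> * h - a) (\<gamma> - 1) * f t)
         - delta_integral h (hsigma h a) b
             (\<lambda>t. hfactorial h (t + \<gamma> * h - hsigma h a) (\<gamma> - 1) * f t))"
proof -
  define w where "w = frac_weight h \<gamma>"
  define fa where "fa n = f (a + real n * h)" for n
  define ga where "ga n = g (a + real n * h)" for n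
  define L where "L n = (\<Sum>j\<le>n. w (n - j) * ga j)" for n
  obtain m where k: "k = Suc m"
    using \<open>k \<ge> 1\<close> by (cases k) auto
  define R where "R j = (\<Sum>i\<le>m - j. w i * fa (j + i))" for j
  have "\<gamma> \<ge> 0" and alpha: "1 - \<alpha> = \<gamma>"
    using assms by auto
  have b: "b = a + real (Suc m) * h" and rho_b: "hrho h b = a + real m * h"
    and b_sigma: "b = hsigma h a + real m * h"
    using assms k by (auto simp: hrho_def hsigma_def algebra_simps)
  have step: "a + real n * h + h = a + real (Suc n) * h" for n
    by (simp add: algebra_simps)

  have left: "left_frac_diff h a \<alpha> g (a + real n * h) * h = L (Suc n) - L n" for n
    using \<open>h > 0\<close> left_frac_sum_grid[OF \<open>h > 0\<close> \<open>\<gamma> \<ge> 0\<close>]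
    by (simp add: left_frac_diff_def alpha delta_deriv_def step L_def w_def ga_def del: of_nat_Suc)
  have right_sum: "right_frac_sum h (hrho h b) \<gamma> f (a + real j * h - \<gamma> * h) = R j" if "j \<le> m" for j
  proof -
    have "hrho h b = a + real j * h + real (m - j) * h"
      using that by (simp add: rho_b of_nat_diff algebra_simps)
    then show ?thesis
      using right_frac_sum_grid[OF \<open>h > 0\<close> \<open>\<gamma> \<ge> 0\<close>, of "a + real j * h" "m - j" f]
      by (simp add: R_def w_def fa_def algebra_simps)
  qed
  have right: "right_frac_diff h (hrho h b) \<alpha> f (a + real j * h) * h = R j - R (Suc j)" if "j < m" for j
    using that \<open>h > 0\<close> right_sum[of j] right_sum[of "Suc j"]
    by (simp add: right_frac_diff_def alpha delta_deriv_def step del: of_nat_Suc)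

  have lhs: "delta_integral h a b (\<lambda>t. f t * left_frac_diff h a \<alpha> g t) =
      (\<Sum>n\<le>m. fa n * (L (Suc n) - L n))"
    unfolding b delta_integral_grid[OF \<open>h > 0\<close>] lessThan_Suc_atMost left[symmetric] fa_def
    by (simp add: mult.assoc)
  have rhs: "delta_integral h a (hrho h b) (\<lambda>t. right_frac_diff h (hrho h b) \<alpha> f t * g (hsigma h t)) =
      (\<Sum>j<m. (R j - R (Suc j)) * ga (Suc j))"
  proof -
    have "delta_integral h a (hrho h b) F = (\<Sum>i<m. F (a + real i * h) * h)" for F
      unfolding rho_b by (rule delta_integral_grid[OF \<open>h > 0\<close>])
    then show ?thesis
      by (auto intro!: sum.cong simp: right[symmetric] hsigma_def step ga_def simp del: of_nat_Suc)
  qed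
  have tail: "\<gamma> / Gamma (\<gamma> + 1) *
      delta_integral h c (c + real p * h) (\<lambda>t. hfactorial h (t + \<gamma> * h - c) (\<gamma> - 1) * f t) =
      (\<Sum>n<p. w (Suc n) * f (c + real n * h))" for c p
  proof -
    have "\<gamma> / Gamma (\<gamma> + 1) *
        delta_integral h c (c + real p * h) (\<lambda>t. hfactorial h (t + \<gamma> * h - c) (\<gamma> - 1) * f t) =
        (\<Sum>n<p. \<gamma> / Gamma (\<gamma> + 1) * (hfactorial h ((real n + \<gamma>) * h) (\<gamma> - 1) * h) * f (c + real n * h))"
      unfolding delta_integral_grid[OF \<open>h > 0\<close>] sum_distrib_left by (simp add: algebra_simps)
    then show ?thesis
      by (simp only: hfactorial_eq_frac_weight_Suc[OF \<open>h > 0\<close> \<open>\<gamma> \<ge> 0\<close>] w_def)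
  qed
  have tail_a: "\<gamma> / Gamma (\<gamma> + 1) *
      delta_integral h a b (\<lambda>t. hfactorial h (t + \<gamma> * h - a) (\<gamma> - 1) * f t) =
      (\<Sum>n\<le>m. w (Suc n) * fa n)"
    unfolding b tail fa_def by (simp add: lessThan_Suc_atMost)
  have tail_sigma: "\<gamma> / Gamma (\<gamma> + 1) *
      delta_integral h (hsigma h a) b (\<lambda>t. hfactorial h (t + \<gamma> * h - hsigma h a) (\<gamma> - 1) * f t) =
      (\<Sum>n<m. w (Suc n) * fa (Suc n))"
    unfolding b_sigma tail fa_def by (simp add: hsigma_def algebra_simps)

  have "(\<Sum>n\<le>m. fa n * (L (Suc n) - L n)) =
      w 0 * fa m * ga (Suc m) - w 0 * fa 0 * ga 0
    + (\<Sum>j<m. (R j - R (Suc j)) * ga (Suc j))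
    + ga 0 * ((\<Sum>n\<le>m. w (Suc n) * fa n) - (\<Sum>n<m. w (Suc n) * fa (Suc n)))"
    unfolding L_def R_def by (rule convolution_summation_by_parts)
  moreover have "w 0 = h powr \<gamma>" "fa m = f (hrho h b)" "fa 0 = f a" "ga 0 = g a"
    by (simp_all add: w_def frac_weight_0 fa_def ga_def rho_b)
  moreover have "ga (Suc m) = g b"
    by (simp only: ga_def b)
  ultimately show ?thesis
    unfolding lhs rhs tail_a[symmetric] tail_sigma[symmetric] by (simp add: algebra_simps)
qed

end
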